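(* Suppose $k\ge 1$ is a constant integer. Then, for any positive constant $\alpha$, as $n\to\infty$, $$\mathbb{P}\big[\mathrm{comp}_{\max}(\mathbf{C}_{n,p})\ge k\big]\to\begin{cases}0,&\text{if } p\ll n^{-1/k},\\ 1-e^{-\alpha^k},&\text{if } p\sim\alpha n^{-1/k},\\ 1,&\text{if } n^{-1/k}\ll p,\end{cases}$$ and $$\mathbb{P}\big[\mathrm{gap}_{\max}(\mathbf{C}_{n,p})\ge k\big]\to\begin{cases}1,&\text{if } q\gg n^{-1/k},\\ 1-e^{-\alpha^k},&\text{if } q\sim\alpha n^{-1/k},\\ 0,&\text{if } n^{-1/k}\gg q.\end{cases}$$
   Context: An $n$-composition is a sequence of $n$ nonnegative integers. For $p=p(n)\in[0,1)$ and $q=1-p$, the geometric random composition $\mathbf{C}_{n,p}$ is the random $n$-composition whose terms are independent, with $\mathbb{P}[\mathbf{C}_{n,p}(i)=j]=qp^j$ for every $j\ge0$ and $i\in\{1,\dots,n\}$. A component of a composition is a maximal run of consecutive nonzero terms; a gap is a maximal run of consecutive zero terms. $\mathrm{comp}_{\max}(C)$ and $\mathrm{gap}_{\max}(C)$ denote the length of the longest component of $C$ and of the longest gap in $C$ (taken to be $0$ if there is none). For positive functions of $n$: $f\ll g$ (or $g\gg f$) means $\lim_{n\to\infty} f/g=0$, and $f\sim g$ means $\lim_{n\to\infty} f/g=1$. *)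

theory Defs
  imports "HOL-Probability.Probability" "HOL-Library.Landau_Symbols"
begin

text \<open>
  An \<open>n\<close>-composition is a \<open>nat list\<close> of length \<open>n\<close>; since list positions start at 0,
  the term \<open>C(i)\<close> is \<open>C ! (i - 1)\<close>.
  A run is represented by its (nonempty) interval of positions, so that equal blocks of terms
  at different places are different runs.
\<close>

definition runs :: "(nat \<Rightarrow> bool) \<Rightarrow> nat list \<Rightarrow> nat set set" where
  "runs P C = {{i..<j} | i j. i < j \<and> j \<le> length C \<and> (\<forall>m\<in>{i..<j}. P (C ! m))}"

definition maximal_runs :: "(nat \<Rightarrow> bool) \<Rightarrow> nat list \<Rightarrow> nat set set" where
  "maximal_runs P C = {I \<in> runs P C. \<forall>J \<in> runs P C. I \<subseteq> J \<longrightarrow> J = I}"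

definition components :: "nat list \<Rightarrow> nat set set" where
  "components C = maximal_runs (\<lambda>x. x \<noteq> 0) C"

definition gaps :: "nat list \<Rightarrow> nat set set" where
  "gaps C = maximal_runs (\<lambda>x. x = 0) C"

definition comp_max :: "nat list \<Rightarrow> nat" where
  "comp_max C = Max (insert 0 (card ` components C))"

definition gap_max :: "nat list \<Rightarrow> nat" where
  "gap_max C = Max (insert 0 (card ` gaps C))"

text \<open>
  The argument of \<^const>\<open>geometric_pmf\<close> is the success probability, here \<open>q = 1 - p\<close>, and the
  distribution counts the failures before the first success.
\<close>

definition geometric_composition :: "nat \<Rightarrow> real \<Rightarrow> nat list pmf" where
  "geometric_composition n p = replicate_pmf n (geometric_pmf (1 - p))"

lemma pmf_geometric_composition:
  assumes "0 \<le> p" "p < 1"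
  shows "pmf (geometric_composition n p) C =
           (if length C = n then \<Prod>i<n. (1 - p) * p ^ (C ! i) else 0)"
proof (cases "length C = n")
  case True
  have "pmf (replicate_pmf (length C) D) C = (\<Prod>i<length C. pmf D (C ! i))"
    for D :: "nat pmf"
  proof (induction C)
    case (Cons x xs)
    have "replicate_pmf (length (x # xs)) D =
            map_pmf (\<lambda>(y, ys). y # ys) (pair_pmf D (replicate_pmf (length xs) D))"
      by (simp add: pair_pmf_def map_bind_pmf bind_map_pmf map_pmf_def bind_assoc_pmf
          bind_return_pmf)
    moreover have "inj (\<lambda>(y :: nat, ys). y # ys)"
      by (auto simp: inj_def)
    ultimately have "pmf (replicate_pmf (length (x # xs)) D) (x # xs) =
        pmf (pair_pmf D (replicate_pmf (length xs) D)) (x, xs)"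
      using pmf_map_inj'[of "\<lambda>(y, ys). y # ys" _ "(x, xs)"] by simp
    also have "\<dots> = (\<Prod>i<length (x # xs). pmf D ((x # xs) ! i))"
      by (simp add: pmf_pair Cons.IH prod.lessThan_Suc_shift del: prod.lessThan_Suc)
    finally show ?case .
  qed simp
  then show ?thesis
    using True assms by (auto simp: geometric_composition_def mult.commute)
next
  case False
  then show ?thesis
    by (auto simp: geometric_composition_def pmf_eq_0_set_pmf set_replicate_pmf)
qed

end

theory Submission
  imports Defs
begin

text \<open>
  Both halves of the theorem concern \<open>n\<close> independent trials of success probability \<open>r\<close>: a nonzero
  term is a success with \<open>r = p\<close> for components, a zero term with \<open>r = q\<close> for gaps. The longest
  component or gap has length at least \<open>k\<close> iff some \<open>k\<close> consecutive trials all succeed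
  (\<open>le_longest_run_iff\<close>). Let \<open>a\<^sub>n\<close> be the probability that this does not happen. Everything follows
  from how \<open>a\<^sub>n\<close> compares with a geometric sequence in \<open>n\<close>.

  Looking at the first run of \<open>k\<close> successes, read from the right, gives the exact recurrence
  \<open>a\<^bsub>n+k+1\<^esub> = a\<^bsub>n+k\<^esub> - r\<^sup>k (1 - r) a\<^sub>n\<close> (\<open>no_run_prob_rec\<close>). Its delayed term lies
  between two multiples of \<open>a\<^bsub>n+k\<^esub>\<close>: monotonicity gives \<open>a\<^bsub>n+k\<^esub> \<le> a\<^sub>n\<close>, and planting a failure
  gives \<open>(1 - r) a\<^sub>n \<le> a\<^bsub>n+k\<^esub>\<close> (\<open>no_run_prob_failure\<close>). Hence
  \<open>(1 - r\<^sup>k)\<^sup>n \<le> a\<^sub>n \<le> (1 - r\<^sup>k (1 - r))\<^bsup>n-k\<^esup>\<close> for \<open>n \<ge> k\<close>. If \<open>r / n\<^bsup>-1/k\<^esup> \<longlonglongrightarrow> \<beta>\<close>, then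
  \<open>n r\<^sup>k \<longlonglongrightarrow> \<beta>\<^sup>k\<close> and \<open>r \<longlonglongrightarrow> 0\<close>, so both bounds tend to \<open>exp (- \<beta>\<^sup>k)\<close>; the case of small \<open>r\<close>
  is \<open>\<beta> = 0\<close> (\<open>prob_has_run_tendsto\<close>).

  For large \<open>r\<close> the upper bound is too weak, because \<open>1 - r\<close> may tend to \<open>0\<close>. There the
  disjoint blocks of length \<open>k\<close>, which are independent, give \<open>a\<^sub>n \<le> (1 - r\<^sup>k)\<^bsup>n div k\<^esup>\<close>, and this tends to
  \<open>0\<close> as soon as \<open>n r\<^sup>k\<close> tends to infinity (\<open>prob_has_run_tendsto_1\<close>).
\<close>

section \<open>Runs of a prescribed length\<close>

definition has_run :: "('a \<Rightarrow> bool) \<Rightarrow> nat \<Rightarrow> 'a list \<Rightarrow> bool" where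
  "has_run P k xs \<longleftrightarrow> (\<exists>i. i + k \<le> length xs \<and> (\<forall>m<k. P (xs ! (i + m))))"

lemma has_run_length: "has_run P k xs \<Longrightarrow> k \<le> length xs"
  by (auto simp: has_run_def)

lemma has_run_at_start:
  "k \<le> length xs \<Longrightarrow> list_all P (take k xs) \<Longrightarrow> has_run P k xs"
  by (auto simp: has_run_def list_all_length intro!: exI[of _ 0])

lemma has_run_drop:
  assumes "has_run P k (drop d xs)" "k \<ge> 1"
  shows "has_run P k xs"
proof -
  obtain i where i: "i + k \<le> length xs - d" "\<forall>m<k. P (drop d xs ! (i + m))"
    using assms by (auto simp: has_run_def)
  then have "(d + i) + k \<le> length xs"
    using assms(2) by simp
  moreover have "P (xs ! ((d + i) + m))" if "m < k" for m
    using i that by (auto simp: add.assoc)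
  ultimately show ?thesis
    unfolding has_run_def by blast
qed

text \<open>
  Every run extends to a maximal one because a list has only finitely many runs, so passing to
  maximal runs does not change the greatest length.
\<close>

lemma le_longest_run_iff:
  assumes "k \<ge> 1"
  shows "k \<le> Max (insert 0 (card ` maximal_runs P C)) \<longleftrightarrow> has_run P k C"
proof -
  have "runs P C \<subseteq> Pow {..<length C}"
    by (auto simp: runs_def)
  then have fin: "finite (runs P C)"
    by (rule finite_subset) auto
  then have fin': "finite (maximal_runs P C)"
    by (simp add: maximal_runs_def)
  have "k \<le> Max (insert 0 (card ` maximal_runs P C)) \<longleftrightarrow> (\<exists>I\<in>maximal_runs P C. k \<le> card I)"
    using fin' assms by (subst Max_ge_iff) auto
  also have "\<dots> \<longleftrightarrow> has_run P k C"
  proof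
    assume "\<exists>I\<in>maximal_runs P C. k \<le> card I"
    then obtain i j where "i < j" "j \<le> length C" "\<forall>m\<in>{i..<j}. P (C ! m)" "k \<le> j - i"
      by (auto simp: maximal_runs_def runs_def)
    then show "has_run P k C"
      by (auto simp: has_run_def intro!: exI[of _ i])
  next
    assume "has_run P k C"
    then obtain i where i: "i + k \<le> length C" "\<forall>m<k. P (C ! (i + m))"
      by (auto simp: has_run_def)
    have "P (C ! m)" if "m \<in> {i..<i + k}" for m
      using i(2)[rule_format, of "m - i"] that by auto
    then have "{i..<i + k} \<in> runs P C"
      using i(1) assms unfolding runs_def by force
    then obtain I where I: "I \<in> runs P C" "{i..<i + k} \<subseteq> I" "\<forall>J\<in>runs P C. I \<subseteq> J \<longrightarrow> I = J"
      using finite_has_maximal2[OF fin] by blast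
    have "finite I"
      using I(1) by (auto simp: runs_def)
    then have "k \<le> card I"
      using card_mono[OF _ I(2)] by simp
    then show "\<exists>I\<in>maximal_runs P C. k \<le> card I"
      using I by (auto simp: maximal_runs_def)
  qed
  finally show ?thesis .
qed

text \<open>
  A failure at position \<open>k\<close> separates the list: no run contains that position, and the part to the
  left of it is shorter than \<open>k\<close> once the first entry has been removed. Conversely, \<open>k\<close> successes at
  the start force such a failure, since the tail would otherwise begin with a run.
\<close>

lemma first_run_at_start_iff:
  assumes "k \<ge> 1" "k < length xs"
  shows "\<not> has_run P k (tl xs) \<and> list_all P (take k xs) \<longleftrightarrow>
    list_all P (take k xs) \<and> \<not> P (xs ! k) \<and> \<not> has_run P k (drop (Suc k) xs)"
proof (intro iffI conjI; elim conjE)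
  assume no: "\<not> has_run P k (tl xs)" and all: "list_all P (take k xs)"
  show "\<not> P (xs ! k)"
  proof
    assume *: "P (xs ! k)"
    have "P (tl xs ! m)" if "m < k" for m
    proof (cases "Suc m = k")
      case False
      then have "Suc m < k"
        using that by simp
      then have "P (xs ! Suc m)"
        using all assms by (auto simp: list_all_length)
      then show ?thesis
        using assms that by (simp add: nth_tl)
    qed (use * assms that in \<open>simp add: nth_tl\<close>)
    then have "has_run P k (tl xs)"
      using assms by (auto simp: has_run_def intro!: exI[of _ 0])
    then show False
      using no by simp
  qed
  show "\<not> has_run P k (drop (Suc k) xs)"
    using no has_run_drop[of P k k "tl xs"] assms by (auto simp: drop_Suc)
next
  assume bad: "\<not> P (xs ! k)" and no: "\<not> has_run P k (drop (Suc k) xs)"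
  show "\<not> has_run P k (tl xs)"
  proof
    assume "has_run P k (tl xs)"
    then obtain i where i: "i + k \<le> length xs - 1" "\<forall>m<k. P (tl xs ! (i + m))"
      by (auto simp: has_run_def)
    have P: "P (xs ! (Suc i + m))" if "m < k" for m
      using i that by (auto simp: nth_tl)
    have "Suc i > k"
    proof (rule ccontr)
      assume "\<not> Suc i > k"
      then show False
        using P[of "k - Suc i"] bad by (auto split: if_splits)
    qed
    then have "i - k + k \<le> length (drop (Suc k) xs) \<and> (\<forall>m<k. P (drop (Suc k) xs ! (i - k + m)))"
      using P i(1) assms by auto
    then show False
      using no unfolding has_run_def by blast
  qed
qed

lemma no_run_if_failure:
  assumes "k \<ge> 1" "k \<le> length xs" "\<not> P (xs ! (k - 1))" "\<not> has_run P k (drop k xs)"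
  shows "\<not> has_run P k xs"
proof
  assume "has_run P k xs"
  then obtain i where i: "i + k \<le> length xs" "\<forall>m<k. P (xs ! (i + m))"
    by (auto simp: has_run_def)
  have "i \<ge> k"
  proof (rule ccontr)
    assume "\<not> i \<ge> k"
    then show False
      using i(2)[rule_format, of "k - 1 - i"] assms(1,3) by auto
  qed
  then have "i - k + k \<le> length (drop k xs) \<and> (\<forall>m<k. P (drop k xs ! (i - k + m)))"
    using i by auto
  then show False
    using assms(4) unfolding has_run_def by blast
qed

lemma has_run_Cons_iff:
  "k \<ge> 1 \<Longrightarrow> k \<le> length xs \<Longrightarrow>
    has_run P k xs \<longleftrightarrow> has_run P k (tl xs) \<or> list_all P (take k xs)"
proof (intro iffI)
  assume k: "k \<ge> 1" "k \<le> length xs" and "has_run P k xs"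
  then obtain i where i: "i + k \<le> length xs" "\<forall>m<k. P (xs ! (i + m))"
    by (auto simp: has_run_def)
  show "has_run P k (tl xs) \<or> list_all P (take k xs)"
  proof (cases i)
    case 0
    then show ?thesis
      using i by (auto simp: list_all_length)
  next
    case (Suc j)
    then have "j + k \<le> length (tl xs) \<and> (\<forall>m<k. P (tl xs ! (j + m)))"
      using i by (auto simp: nth_tl)
    then show ?thesis
      unfolding has_run_def by blast
  qed
qed (use has_run_drop[of P k 1 xs] has_run_at_start[of k xs P] in \<open>auto simp: drop_Suc\<close>)

section \<open>Independent trials\<close>

lemma prob_pair_pmf_Times:
  "measure_pmf.prob (pair_pmf M N) (A \<times> B) = measure_pmf.prob M A * measure_pmf.prob N B"
proof -
  have "measure_pmf.prob (pair_pmf M N) (A \<times> B) =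
      measure_pmf.prob (pair_pmf M N) ((A \<inter> set_pmf M) \<times> (B \<inter> set_pmf N))"
    by (subst measure_Int_set_pmf[symmetric]) (simp add: Times_Int_Times)
  also have "\<dots> = measure_pmf.prob M (A \<inter> set_pmf M) * measure_pmf.prob N (B \<inter> set_pmf N)"
    by (intro measure_pmf_prob_product) auto
  finally show ?thesis
    by (simp add: measure_Int_set_pmf)
qed

lemma prob_replicate_pmf_split:
  "measure_pmf.prob (replicate_pmf (m + n) D) {xs. take m xs \<in> A \<and> drop m xs \<in> B} =
    measure_pmf.prob (replicate_pmf m D) A * measure_pmf.prob (replicate_pmf n D) B"
proof -
  let ?E = "{xs. take m xs \<in> A \<and> drop m xs \<in> B}"
  let ?M = "pair_pmf (replicate_pmf m D) (replicate_pmf n D)"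
  have "replicate_pmf (m + n) D = map_pmf (\<lambda>(xs, ys). xs @ ys) ?M"
    by (simp add: replicate_pmf_distrib pair_pmf_def map_bind_pmf bind_return_pmf map_pmf_def
        bind_assoc_pmf)
  then have "measure_pmf.prob (replicate_pmf (m + n) D) ?E =
      measure_pmf.prob ?M ((\<lambda>(xs, ys). xs @ ys) -` ?E)"
    by simp
  also have "\<dots> = measure_pmf.prob ?M (A \<times> B)"
    by (intro measure_prob_cong_0) (auto simp: pmf_eq_0_set_pmf set_replicate_pmf)
  finally show ?thesis
    by (simp add: prob_pair_pmf_Times)
qed

lemma prob_replicate_pmf_1:
  "measure_pmf.prob (replicate_pmf 1 D) {xs. P (hd xs)} = measure_pmf.prob D {x. P x}"
  unfolding replicate_pmf_1 by (simp add: vimage_def)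

lemma prob_replicate_pmf_split_nth:
  "measure_pmf.prob (replicate_pmf (Suc (m + n)) D)
      {xs. take m xs \<in> A \<and> P (xs ! m) \<and> drop (Suc m) xs \<in> B} =
    measure_pmf.prob (replicate_pmf m D) A * measure_pmf.prob D {x. P x} *
      measure_pmf.prob (replicate_pmf n D) B"
proof -
  have "measure_pmf.prob (replicate_pmf (m + (1 + n)) D)
      {xs. take m xs \<in> A \<and> drop m xs \<in> {ys. take 1 ys \<in> {ys. P (hd ys)} \<and> drop 1 ys \<in> B}} =
    measure_pmf.prob (replicate_pmf m D) A * (measure_pmf.prob D {x. P x} *
      measure_pmf.prob (replicate_pmf n D) B)"
    by (simp only: prob_replicate_pmf_split prob_replicate_pmf_1)
  moreover have "measure_pmf.prob (replicate_pmf (m + (1 + n)) D)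
      {xs. take m xs \<in> A \<and> drop m xs \<in> {ys. take 1 ys \<in> {ys. P (hd ys)} \<and> drop 1 ys \<in> B}} =
    measure_pmf.prob (replicate_pmf (m + (1 + n)) D)
      {xs. take m xs \<in> A \<and> P (xs ! m) \<and> drop (Suc m) xs \<in> B}"
    by (intro measure_prob_cong_0)
      (auto simp: pmf_eq_0_set_pmf set_replicate_pmf hd_drop_conv_nth simp flip: drop_Suc)
  ultimately show ?thesis
    by (simp add: mult.assoc)
qed

lemma prob_replicate_pmf_all:
  "measure_pmf.prob (replicate_pmf n D) {xs. list_all P xs} = measure_pmf.prob D {x. P x} ^ n"
proof (induction n)
  case (Suc n)
  have "measure_pmf.prob (replicate_pmf (Suc (0 + n)) D)
      {xs. take 0 xs \<in> UNIV \<and> P (xs ! 0) \<and> drop (Suc 0) xs \<in> {xs. list_all P xs}} =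
    measure_pmf.prob D {x. P x} ^ Suc n"
    by (simp only: prob_replicate_pmf_split_nth Suc.IH) simp
  moreover have "measure_pmf.prob (replicate_pmf (Suc n) D) {xs. list_all P xs} =
      measure_pmf.prob (replicate_pmf (Suc n) D)
      {xs. take 0 xs \<in> UNIV \<and> P (xs ! 0) \<and> drop (Suc 0) xs \<in> {xs. list_all P xs}}"
    by (intro measure_prob_cong_0)
      (auto simp: pmf_eq_0_set_pmf set_replicate_pmf length_Suc_conv simp del: replicate_pmf.simps)
  ultimately show ?case
    by simp
qed auto

section \<open>The probability of seeing no long run\<close>

lemma one_minus_pow_le_exp:
  fixes x :: real
  assumes "x \<le> 1"
  shows "(1 - x) ^ n \<le> exp (- (real n * x))"
proof -
  have "(1 - x) ^ n \<le> exp (- x) ^ n"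
    using assms exp_ge_add_one_self[of "- x"] by (intro power_mono) auto
  then show ?thesis
    by (simp flip: exp_of_nat_mult)
qed

locale trials =
  fixes D :: "'a pmf" and P :: "'a \<Rightarrow> bool" and k :: nat
  assumes k_pos: "k \<ge> 1"
begin

definition r :: real where "r = measure_pmf.prob D {x. P x}"

definition no_run_prob :: "nat \<Rightarrow> real" where
  "no_run_prob n = measure_pmf.prob (replicate_pmf n D) {xs. \<not> has_run P k xs}"

lemma r_bounds: "0 \<le> r" "r \<le> 1"
  by (simp_all add: r_def)

lemma r_pow_bounds: "0 \<le> r ^ k" "r ^ k \<le> 1"
  using r_bounds by (simp_all add: power_le_one)

lemma no_run_prob_bounds: "0 \<le> no_run_prob n" "no_run_prob n \<le> 1"
  by (simp_all add: no_run_prob_def)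

lemma prob_failure: "measure_pmf.prob D {x. \<not> P x} = 1 - r"
proof -
  have "{x. \<not> P x} = - {x. P x}"
    by auto
  then show ?thesis
    unfolding r_def using measure_pmf.prob_compl[of "{x. P x}" D] by (simp add: Compl_eq_Diff_UNIV)
qed

lemma no_run_prob_short: "n < k \<Longrightarrow> no_run_prob n = 1"
  unfolding no_run_prob_def
  by (subst measure_pmf.prob_eq_1)
    (auto simp: AE_measure_pmf_iff set_replicate_pmf dest: has_run_length)

lemma no_run_prob_eq: "no_run_prob k = 1 - r ^ k"
proof -
  have "no_run_prob k = measure_pmf.prob (replicate_pmf k D) (UNIV - {xs. list_all P xs})"
    unfolding no_run_prob_def
    by (intro measure_prob_cong_0)
      (auto simp: pmf_eq_0_set_pmf set_replicate_pmf has_run_def list_all_length)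
  also have "\<dots> = 1 - r ^ k"
    using measure_pmf.prob_compl[of "{xs. list_all P xs}" "replicate_pmf k D"]
    by (simp add: prob_replicate_pmf_all r_def)
  finally show ?thesis .
qed

text \<open>
  Prepending a trial to a list without runs creates a run exactly when the new list begins with \<open>k\<close>
  successes and a failure and the remaining trials contain no run; these three conditions are
  independent.
\<close>

lemma no_run_prob_rec:
  "no_run_prob (Suc (k + n)) = no_run_prob (k + n) - r ^ k * (1 - r) * no_run_prob n"
proof -
  let ?M = "replicate_pmf (Suc (k + n)) D"
  let ?S = "{xs. \<not> has_run P k (tl xs)}" and ?T = "{xs. \<not> has_run P k xs}"
  let ?B = "{xs. take k xs \<in> {xs. list_all P xs} \<and> \<not> P (xs ! k) \<and>
    drop (Suc k) xs \<in> {xs. \<not> has_run P k xs}}"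
  have S: "measure_pmf.prob ?M ?S = no_run_prob (k + n)"
    using prob_replicate_pmf_split[of 1 "k + n" D UNIV "{xs. \<not> has_run P k xs}"]
    by (simp add: no_run_prob_def drop_Suc del: replicate_pmf.simps)
  have B: "measure_pmf.prob ?M ?B = r ^ k * (1 - r) * no_run_prob n"
    unfolding prob_replicate_pmf_split_nth[where P = "\<lambda>x. \<not> P x"] prob_replicate_pmf_all prob_failure
    by (simp add: r_def no_run_prob_def)
  have "measure_pmf.prob ?M ?S = measure_pmf.prob ?M (?T \<union> ?B)"
  proof (intro measure_prob_cong_0)
    fix xs assume "xs \<in> ?S - (?T \<union> ?B)"
    then show "pmf ?M xs = 0"
      using first_run_at_start_iff[of k xs P] has_run_Cons_iff[of k xs P] k_pos
      by (auto simp: pmf_eq_0_set_pmf set_replicate_pmf simp del: replicate_pmf.simps)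
  next
    fix xs assume "xs \<in> (?T \<union> ?B) - ?S"
    then show "pmf ?M xs = 0"
      using first_run_at_start_iff[of k xs P] has_run_Cons_iff[of k xs P] k_pos
      by (auto simp: pmf_eq_0_set_pmf set_replicate_pmf simp del: replicate_pmf.simps)
  qed
  also have "\<dots> = measure_pmf.prob ?M ?T + measure_pmf.prob ?M (?B - ?T)"
    by (subst measure_pmf.finite_measure_Union[symmetric]) (auto intro: arg_cong2[of _ _ _ _ measure])
  also have "measure_pmf.prob ?M (?B - ?T) = measure_pmf.prob ?M ?B"
    using has_run_at_start[of k _ P]
    by (intro measure_prob_cong_0)
      (auto simp: pmf_eq_0_set_pmf set_replicate_pmf simp del: replicate_pmf.simps)
  finally show ?thesis
    using S B by (simp add: no_run_prob_def)
qed

text \<open>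
  This controls the delayed term of the recurrence: a failure as the last of \<open>k\<close> prepended trials
  shields the rest of the list from them.
\<close>

lemma no_run_prob_failure: "(1 - r) * no_run_prob n \<le> no_run_prob (k + n)"
proof -
  obtain j where j: "k = Suc j"
    using k_pos by (cases k) auto
  let ?B = "{xs. take j xs \<in> UNIV \<and> \<not> P (xs ! j) \<and> drop (Suc j) xs \<in> {xs. \<not> has_run P k xs}}"
  have "(1 - r) * no_run_prob n = measure_pmf.prob (replicate_pmf (Suc (j + n)) D) ?B"
    unfolding prob_replicate_pmf_split_nth[where P = "\<lambda>x. \<not> P x"] prob_failure
    by (simp add: no_run_prob_def)
  also have "\<dots> = measure_pmf.prob (replicate_pmf (Suc (j + n)) D)
      (?B \<inter> set_pmf (replicate_pmf (Suc (j + n)) D))"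
    by (simp only: measure_Int_set_pmf)
  also have "\<dots> \<le> no_run_prob (Suc (j + n))"
    unfolding no_run_prob_def
    by (intro measure_pmf.finite_measure_mono subsetI)
      (use no_run_if_failure[of k _ P] in
        \<open>auto simp: set_replicate_pmf j simp del: replicate_pmf.simps\<close>)
  finally show ?thesis
    by (simp add: j)
qed

text \<open>
  Without a run, the first \<open>k\<close> trials include a failure and the others contain no run; these two
  conditions are independent.
\<close>

lemma no_run_prob_block: "no_run_prob (k + n) \<le> (1 - r ^ k) * no_run_prob n"
proof -
  let ?A = "{xs. \<not> has_run P k xs}"
  let ?M = "replicate_pmf (k + n) D"
  have "no_run_prob (k + n) = measure_pmf.prob ?M (?A \<inter> set_pmf ?M)"
    by (simp add: no_run_prob_def measure_Int_set_pmf)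
  also have "\<dots> \<le> measure_pmf.prob ?M {xs. take k xs \<in> ?A \<and> drop k xs \<in> ?A}"
  proof (intro measure_pmf.finite_measure_mono subsetI)
    fix xs assume xs: "xs \<in> ?A \<inter> set_pmf ?M"
    have "\<not> has_run P k (take k xs)"
    proof
      assume "has_run P k (take k xs)"
      then have "list_all P (take k xs)"
        by (auto simp: has_run_def list_all_length)
      then show False
        using xs has_run_at_start[of k xs P] by (auto simp: set_replicate_pmf)
    qed
    then show "xs \<in> {xs. take k xs \<in> ?A \<and> drop k xs \<in> ?A}"
      using xs has_run_drop[of P k k xs] k_pos by auto
  qed simp
  also have "\<dots> = no_run_prob k * no_run_prob n"
    unfolding prob_replicate_pmf_split no_run_prob_def ..
  finally show ?thesis
    by (simp add: no_run_prob_eq)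
qed

lemma no_run_prob_antimono:
  assumes "m \<le> n"
  shows "no_run_prob n \<le> no_run_prob m"
proof -
  have "no_run_prob (Suc n) \<le> no_run_prob n" for n
  proof (cases "n < k")
    case False
    then obtain d where "n = k + d"
      using le_Suc_ex[of k n] by auto
    then show ?thesis
      using no_run_prob_rec[of d] r_bounds r_pow_bounds no_run_prob_bounds[of d] by simp
  qed (simp add: no_run_prob_short no_run_prob_bounds)
  then show ?thesis
    using assms lift_Suc_antimono_le by blast
qed

lemma no_run_prob_ge: "(1 - r ^ k) ^ n \<le> no_run_prob n"
proof (induction n)
  case (Suc n)
  have "(1 - r ^ k) * no_run_prob n \<le> no_run_prob (Suc n)"
  proof (cases "k \<le> n")
    case True
    then obtain d where "n = k + d"
      using le_Suc_ex by blast
    then show ?thesis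
      using no_run_prob_rec[of d] mult_left_mono[OF no_run_prob_failure[of d] r_pow_bounds(1)]
      by (simp add: algebra_simps)
  next
    case False
    then consider "Suc n < k" | "Suc n = k"
      by linarith
    then show ?thesis
    proof cases
      case 1
      then show ?thesis
        using r_pow_bounds no_run_prob_bounds[of n] by (simp add: no_run_prob_short mult_le_one)
    next
      case 2
      then show ?thesis
        using r_pow_bounds by (simp add: no_run_prob_short no_run_prob_eq)
    qed
  qed
  moreover have "(1 - r ^ k) ^ Suc n \<le> (1 - r ^ k) * no_run_prob n"
    using Suc r_pow_bounds by (simp add: mult_left_mono)
  ultimately show ?case
    by linarith
qed (use no_run_prob_short[of 0] k_pos in simp)

lemma no_run_prob_le: "no_run_prob (k + n) \<le> (1 - r ^ k * (1 - r)) ^ n"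
proof (induction n)
  case (Suc n)
  have s: "0 \<le> r ^ k * (1 - r)" "r ^ k * (1 - r) \<le> 1"
    using r_bounds r_pow_bounds by (auto intro: mult_le_one)
  have "no_run_prob (k + Suc n) = no_run_prob (k + n) - r ^ k * (1 - r) * no_run_prob n"
    using no_run_prob_rec[of n] by simp
  also have "\<dots> \<le> (1 - r ^ k * (1 - r)) * no_run_prob (k + n)"
    using mult_left_mono[OF no_run_prob_antimono[of n "k + n"] s(1)] by (simp add: left_diff_distrib)
  also have "\<dots> \<le> (1 - r ^ k * (1 - r)) * (1 - r ^ k * (1 - r)) ^ n"
    using Suc s by (intro mult_left_mono) auto
  finally show ?case
    by simp
qed (simp add: no_run_prob_bounds)

lemma no_run_prob_le_blocks: "no_run_prob n \<le> (1 - r ^ k) ^ (n div k)"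
proof -
  have "no_run_prob (k * m) \<le> (1 - r ^ k) ^ m" for m
  proof (induction m)
    case (Suc m)
    have "no_run_prob (k * Suc m) \<le> (1 - r ^ k) * no_run_prob (k * m)"
      using no_run_prob_block[of "k * m"] by simp
    also have "\<dots> \<le> (1 - r ^ k) * (1 - r ^ k) ^ m"
      using Suc r_pow_bounds by (intro mult_left_mono) auto
    finally show ?case
      by simp
  qed (simp add: no_run_prob_bounds)
  from this[of "n div k"] no_run_prob_antimono[of "k * (n div k)" n] show ?thesis
    by simp
qed

text \<open>
  The difference of \<open>n\<close> and \<open>k\<close> is taken in the reals, so that for \<open>n < k\<close> the right-hand side is at
  least \<open>1\<close> and the bound is trivial.
\<close>

lemma no_run_prob_le_exp: "no_run_prob n \<le> exp (- ((real n - real k) * (r ^ k * (1 - r))))"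
proof (cases "k \<le> n")
  case True
  then obtain d where d: "n = k + d"
    using le_Suc_ex by blast
  have "r ^ k * (1 - r) \<le> 1"
    using r_bounds r_pow_bounds by (intro mult_le_one) auto
  then show ?thesis
    using no_run_prob_le[of d] one_minus_pow_le_exp[of "r ^ k * (1 - r)" d] d by simp
next
  case False
  then have "0 \<le> - ((real n - real k) * (r ^ k * (1 - r)))"
    using r_bounds r_pow_bounds by (auto simp: mult_nonpos_nonneg)
  then show ?thesis
    using no_run_prob_bounds[of n] by (meson one_le_exp_iff order_trans)
qed

text \<open>
  The summand \<open>1\<close> in the exponent pays for the trials left over by the division into blocks. The bound
  has no factor \<open>1 - r\<close> and so stays useful when \<open>r\<close> is close to \<open>1\<close>.
\<close>

lemma no_run_prob_le_exp_blocks: "no_run_prob n \<le> exp (1 - real n * r ^ k / real k)"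
proof -
  have "real n / real k - 1 \<le> real (n div k)"
    using floor_divide_of_nat_eq[of n k, where ?'a = real] by linarith
  from mult_right_mono[OF this r_pow_bounds(1)]
  have "- (real (n div k) * r ^ k) \<le> r ^ k - real n * r ^ k / real k"
    by (simp add: algebra_simps)
  also have "\<dots> \<le> 1 - real n * r ^ k / real k"
    using r_pow_bounds(2) by simp
  finally have "exp (- (real (n div k) * r ^ k)) \<le> exp (1 - real n * r ^ k / real k)"
    by simp
  moreover have "no_run_prob n \<le> exp (- (real (n div k) * r ^ k))"
    using no_run_prob_le_blocks[of n] one_minus_pow_le_exp[OF r_pow_bounds(2), of "n div k"] by simp
  ultimately show ?thesis
    by (rule order_trans[rotated])
qed

lemma no_run_prob_ge_exp:
  assumes "r ^ k < 1"
  shows "exp (- (real n * r ^ k / (1 - r ^ k))) \<le> no_run_prob n"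
proof -
  let ?x = "r ^ k"
  \<comment> \<open>\<open>1 / (1 - x) = 1 + x / (1 - x) \<le> exp (x / (1 - x))\<close>\<close>
  have "1 / (1 - ?x) \<le> exp (?x / (1 - ?x))"
    using assms exp_ge_add_one_self[of "?x / (1 - ?x)"] by (simp add: field_simps)
  then have "exp (- (?x / (1 - ?x))) \<le> 1 - ?x"
    using assms by (simp add: exp_minus field_simps)
  then have "exp (- (?x / (1 - ?x))) ^ n \<le> (1 - ?x) ^ n"
    by (intro power_mono) auto
  then show ?thesis
    using no_run_prob_ge[of n] by (simp flip: exp_of_nat_mult)
qed

lemma prob_has_run: "measure_pmf.prob (replicate_pmf n D) {xs. has_run P k xs} = 1 - no_run_prob n"
proof -
  have "{xs. \<not> has_run P k xs} = UNIV - {xs. has_run P k xs}"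
    by auto
  then show ?thesis
    unfolding no_run_prob_def
    using measure_pmf.prob_compl[of "{xs. has_run P k xs}" "replicate_pmf n D"] by simp
qed

end

section \<open>The three regimes\<close>

text \<open>
  The limit \<open>\<beta>\<close> may be \<open>0\<close>, so this covers both a negligible and a critical success probability.
\<close>

lemma prob_has_run_tendsto:
  fixes D :: "nat \<Rightarrow> 'a pmf"
  assumes k: "k \<ge> 1"
    and r: "\<And>n. r n = measure_pmf.prob (D n) {x. P x}"
    and lim: "(\<lambda>n. r n / real n powr (- 1 / real k)) \<longlonglongrightarrow> \<beta>"
  shows "(\<lambda>n. measure_pmf.prob (replicate_pmf n (D n)) {xs. has_run P k xs}) \<longlonglongrightarrow> 1 - exp (- (\<beta> ^ k))"
proof -
  have tr: "trials k"
    by (rule trials.intro[OF k])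
  define a where "a n = trials.no_run_prob (D n) P k n" for n
  have r_eq: "trials.r (D n) P = r n" for n
    by (simp add: trials.r_def[OF tr] r)
  have scale: "(\<lambda>n. real n powr (- 1 / real k)) \<longlonglongrightarrow> 0"
    using k by (intro tendsto_neg_powr filterlim_real_sequentially) auto
  have "\<forall>\<^sub>F n in sequentially. r n / real n powr (- 1 / real k) * real n powr (- 1 / real k) = r n"
    using eventually_gt_at_top[of 0] by eventually_elim auto
  from Lim_transform_eventually[OF tendsto_mult[OF lim scale] this]
  have r0: "r \<longlonglongrightarrow> 0"
    by simp
  have rk0: "(\<lambda>n. r n ^ k) \<longlonglongrightarrow> 0"
    using tendsto_power[OF r0, of k] k by (simp add: power_0_left)
  have "\<forall>\<^sub>F n in sequentially. (r n / real n powr (- 1 / real k)) ^ k = real n * r n ^ k"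
    using eventually_gt_at_top[of 0]
    by eventually_elim (use k in \<open>simp add: power_divide powr_power powr_minus field_simps\<close>)
  from Lim_transform_eventually[OF tendsto_power[OF lim] this]
  have nrk: "(\<lambda>n. real n * r n ^ k) \<longlonglongrightarrow> \<beta> ^ k" .
  have upper: "(\<lambda>n. exp (- ((real n - real k) * (r n ^ k * (1 - r n))))) \<longlonglongrightarrow> exp (- (\<beta> ^ k))"
  proof -
    have "(\<lambda>n. exp (- ((real n * r n ^ k - real k * r n ^ k) * (1 - r n))))
        \<longlonglongrightarrow> exp (- ((\<beta> ^ k - real k * 0) * (1 - 0)))"
      by (intro tendsto_intros nrk rk0 r0)
    then show ?thesis
      by (simp add: algebra_simps)
  qed
  have lower: "(\<lambda>n. exp (- (real n * r n ^ k / (1 - r n ^ k)))) \<longlonglongrightarrow> exp (- (\<beta> ^ k))"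
  proof -
    have "(\<lambda>n. exp (- (real n * r n ^ k / (1 - r n ^ k)))) \<longlonglongrightarrow> exp (- (\<beta> ^ k / (1 - 0)))"
      by (intro tendsto_intros nrk rk0) auto
    then show ?thesis
      by simp
  qed
  have "\<forall>\<^sub>F n in sequentially. exp (- (real n * r n ^ k / (1 - r n ^ k))) \<le> a n"
    using order_tendstoD(2)[OF rk0 zero_less_one]
  proof eventually_elim
    case (elim n)
    then show ?case
      using trials.no_run_prob_ge_exp[OF tr, of "D n" P n] by (simp add: a_def r_eq)
  qed
  moreover have "\<forall>\<^sub>F n in sequentially. a n \<le> exp (- ((real n - real k) * (r n ^ k * (1 - r n))))"
    using trials.no_run_prob_le_exp[OF tr, of _ P] by (intro always_eventually) (metis a_def r_eq)
  ultimately have "a \<longlonglongrightarrow> exp (- (\<beta> ^ k))"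
    by (rule tendsto_sandwich[OF _ _ lower upper])
  then show ?thesis
    unfolding trials.prob_has_run[OF tr] a_def by (intro tendsto_intros)
qed

lemma prob_has_run_tendsto_1:
  fixes D :: "nat \<Rightarrow> 'a pmf"
  assumes k: "k \<ge> 1"
    and r: "\<And>n. r n = measure_pmf.prob (D n) {x. P x}"
    and small: "(\<lambda>n. real n powr (- 1 / real k)) \<in> o(r)"
  shows "(\<lambda>n. measure_pmf.prob (replicate_pmf n (D n)) {xs. has_run P k xs}) \<longlonglongrightarrow> 1"
proof -
  have tr: "trials k"
    by (rule trials.intro[OF k])
  define a where "a n = trials.no_run_prob (D n) P k n" for n
  have r_eq: "trials.r (D n) P = r n" for n
    by (simp add: trials.r_def[OF tr] r)
  have r_nonneg: "r n \<ge> 0" for n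
    by (simp add: r)
  have "filterlim (\<lambda>n. real n * r n ^ k) at_top sequentially"
    unfolding filterlim_at_top_gt[where c = 0]
  proof (intro allI impI)
    fix Z :: real
    assume Z: "Z > 0"
    \<comment> \<open>With constant \<open>c\<close>, \<open>small\<close> amounts to \<open>1 \<le> c\<^sup>k n r\<^sup>k\<close> for large \<open>n\<close>; take \<open>c\<^sup>k = 1 / Z\<close>.\<close>
    define c where "c = root k (1 / Z)"
    have c: "c > 0" "c ^ k = 1 / Z"
      using Z k by (simp_all add: c_def)
    have "\<forall>\<^sub>F n in sequentially. norm (real n powr (- 1 / real k)) \<le> c * norm (r n)"
      using landau_o.smallD[OF small c(1)] .
    then show "\<forall>\<^sub>F n in sequentially. Z \<le> real n * r n ^ k"
      using eventually_gt_at_top[of 0]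
    proof eventually_elim
      case (elim n)
      then have "(real n powr (- 1 / real k)) ^ k \<le> (c * r n) ^ k"
        using r_nonneg[of n] by (intro power_mono) auto
      then have "1 / real n \<le> r n ^ k / Z"
        using k elim c by (simp add: powr_power powr_minus power_mult_distrib field_simps)
      then show ?case
        using elim Z by (simp add: field_simps)
    qed
  qed
  then have "filterlim (\<lambda>n. 1 + - (1 / real k) * (real n * r n ^ k)) at_bot sequentially"
    using k by (intro filterlim_tendsto_add_at_bot_iff[OF tendsto_const, THEN iffD2]
        filterlim_tendsto_neg_mult_at_bot[OF tendsto_const]) auto
  then have "(\<lambda>n. exp (1 - real n * r n ^ k / real k)) \<longlonglongrightarrow> 0"
    using filterlim_compose[OF exp_at_bot] by simp
  moreover have "a n \<le> exp (1 - real n * r n ^ k / real k)" "0 \<le> a n" for n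
    using trials.no_run_prob_le_exp_blocks[OF tr, of "D n" P n]
      trials.no_run_prob_bounds(1)[OF tr, of "D n" P n] by (simp_all add: a_def r_eq)
  ultimately have "a \<longlonglongrightarrow> 0"
    by (intro tendsto_sandwich[of "\<lambda>_. 0" a sequentially]) auto
  then have "(\<lambda>n. 1 - a n) \<longlonglongrightarrow> 1 - 0"
    by (intro tendsto_intros)
  then show ?thesis
    unfolding trials.prob_has_run[OF tr] a_def by simp
qed

lemma prob_has_run_regimes:
  fixes D :: "nat \<Rightarrow> 'a pmf"
  assumes k: "k \<ge> 1" and "\<alpha> > 0"
    and r: "\<And>n. r n = measure_pmf.prob (D n) {x. P x}"
  defines "f \<equiv> \<lambda>n. measure_pmf.prob (replicate_pmf n (D n)) {xs. has_run P k xs}"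
  shows "r \<in> o(\<lambda>n. real n powr (- 1 / real k)) \<Longrightarrow> f \<longlonglongrightarrow> 0"
    and "r \<sim>[sequentially] (\<lambda>n. \<alpha> * real n powr (- 1 / real k)) \<Longrightarrow> f \<longlonglongrightarrow> 1 - exp (- (\<alpha> ^ k))"
    and "(\<lambda>n. real n powr (- 1 / real k)) \<in> o(r) \<Longrightarrow> f \<longlonglongrightarrow> 1"
proof -
  assume "r \<in> o(\<lambda>n. real n powr (- 1 / real k))"
  from prob_has_run_tendsto[OF k r smalloD_tendsto[OF this]] show "f \<longlonglongrightarrow> 0"
    using k by (simp add: f_def power_0_left)
next
  let ?g = "\<lambda>n. \<alpha> * real n powr (- 1 / real k)"
  assume "r \<sim>[sequentially] ?g"
  from tendsto_mult_left[OF asymp_equivD[OF this], of \<alpha>]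
  have "(\<lambda>n. \<alpha> * (if r n = 0 \<and> ?g n = 0 then 1 else r n / ?g n)) \<longlonglongrightarrow> \<alpha>"
    by simp
  moreover have "\<forall>\<^sub>F n in sequentially.
      \<alpha> * (if r n = 0 \<and> ?g n = 0 then 1 else r n / ?g n) = r n / real n powr (- 1 / real k)"
    using eventually_gt_at_top[of 0] by eventually_elim (use \<open>\<alpha> > 0\<close> in auto)
  ultimately have "(\<lambda>n. r n / real n powr (- 1 / real k)) \<longlonglongrightarrow> \<alpha>"
    by (rule Lim_transform_eventually)
  from prob_has_run_tendsto[OF k r this] show "f \<longlonglongrightarrow> 1 - exp (- (\<alpha> ^ k))"
    by (simp add: f_def)
next
  assume "(\<lambda>n. real n powr (- 1 / real k)) \<in> o(r)"
  from prob_has_run_tendsto_1[OF k r this] show "f \<longlonglongrightarrow> 1"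
    by (simp add: f_def)
qed

lemma prob_geometric_pmf_zero:
  assumes "0 \<le> p" "p < 1"
  shows "measure_pmf.prob (geometric_pmf (1 - p)) {x. x = 0} = 1 - p"
    and "measure_pmf.prob (geometric_pmf (1 - p)) {x. x \<noteq> 0} = p"
proof -
  show *: "measure_pmf.prob (geometric_pmf (1 - p)) {x. x = 0} = 1 - p"
    using assms by (simp add: measure_pmf_single)
  have "{x::nat. x \<noteq> 0} = UNIV - {x. x = 0}"
    by auto
  then show "measure_pmf.prob (geometric_pmf (1 - p)) {x. x \<noteq> 0} = p"
    using measure_pmf.prob_compl[of "{x. x = 0}" "geometric_pmf (1 - p)"] * by simp
qed

theorem proposition3p3:
  fixes p q :: "nat \<Rightarrow> real" and k :: nat and \<alpha> :: real
  assumes "k \<ge> 1" and "\<alpha> > 0"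
    and "\<And>n. 0 \<le> p n \<and> p n < 1"
    and "\<And>n. q n = 1 - p n"
  shows
    "(p \<in> o(\<lambda>n. real n powr (- 1 / real k)) \<longrightarrow>
        (\<lambda>n. measure_pmf.prob (geometric_composition n (p n)) {C. comp_max C \<ge> k}) \<longlonglongrightarrow> 0)
     \<and> (p \<sim>[sequentially] (\<lambda>n. \<alpha> * real n powr (- 1 / real k)) \<longrightarrow>
        (\<lambda>n. measure_pmf.prob (geometric_composition n (p n)) {C. comp_max C \<ge> k})
          \<longlonglongrightarrow> 1 - exp (- (\<alpha> ^ k)))
     \<and> ((\<lambda>n. real n powr (- 1 / real k)) \<in> o(p) \<longrightarrow>
        (\<lambda>n. measure_pmf.prob (geometric_composition n (p n)) {C. comp_max C \<ge> k}) \<longlonglongrightarrow> 1)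
     \<and> ((\<lambda>n. real n powr (- 1 / real k)) \<in> o(q) \<longrightarrow>
        (\<lambda>n. measure_pmf.prob (geometric_composition n (p n)) {C. gap_max C \<ge> k}) \<longlonglongrightarrow> 1)
     \<and> (q \<sim>[sequentially] (\<lambda>n. \<alpha> * real n powr (- 1 / real k)) \<longrightarrow>
        (\<lambda>n. measure_pmf.prob (geometric_composition n (p n)) {C. gap_max C \<ge> k})
          \<longlonglongrightarrow> 1 - exp (- (\<alpha> ^ k)))
     \<and> (q \<in> o(\<lambda>n. real n powr (- 1 / real k)) \<longrightarrow>
        (\<lambda>n. measure_pmf.prob (geometric_composition n (p n)) {C. gap_max C \<ge> k}) \<longlonglongrightarrow> 0)"
proof -
  have p: "0 \<le> p n" "p n < 1" for n
    using assms(3) by auto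
  have comp: "{C. comp_max C \<ge> k} = {C. has_run (\<lambda>x. x \<noteq> 0) k C}"
    using le_longest_run_iff[OF assms(1)] by (simp add: comp_max_def components_def)
  have gap: "{C. gap_max C \<ge> k} = {C. has_run (\<lambda>x. x = 0) k C}"
    using le_longest_run_iff[OF assms(1)] by (simp add: gap_max_def gaps_def)
  have "p n = measure_pmf.prob (geometric_pmf (1 - p n)) {x. x \<noteq> 0}" for n
    using prob_geometric_pmf_zero(2)[OF p] by simp
  note c = prob_has_run_regimes[where r = p, OF assms(1,2) this]
  have "q n = measure_pmf.prob (geometric_pmf (1 - p n)) {x. x = 0}" for n
    using prob_geometric_pmf_zero(1)[OF p] assms(4) by simp
  note g = prob_has_run_regimes[where r = q, OF assms(1,2) this]
  show ?thesis
    unfolding comp gap geometric_composition_def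
    by (intro conjI impI; (rule c | rule g); assumption)
qed

end
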